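(* Let $N,d\ge1$ be integers, $T>0$, $\gamma\in(\frac1{N+1},\frac1N]$, and let $\mathbf X:[0,T]\to G_N$ be such that $\langle\mathbf X_t,\sigma\rangle=0$ for all $t\in[0,T]$ and all nonempty trees $\sigma$ with $|\sigma|\le\lfloor N/2\rfloor$. Then $\mathbf X$ is a $\gamma$-Hölder branched rough path if and only if for every tree shape $\tau$ with $\lfloor N/2\rfloor<|\tau|\le N$ there exists $f^\tau\in C^{\gamma|\tau|}([0,T],(\mathbb R^d)^{\otimes|\tau|})$ such that $$\mathbf X_t=\mathbf 1+\sum_{\tau:\ \lfloor N/2\rfloor<|\tau|\le N}f^\tau(t)\,\tau,\qquad t\in[0,T].$$ Moreover, in this case, for all $s,t\in[0,T]$ with $s<t$, $$\mathbf X_{st}=\mathbf X_s^{-1}\star\mathbf X_t=\mathbf 1+\sum_{\tau:\ \lfloor N/2\rfloor<|\tau|\le N}\big(f^\tau(t)-f^\tau(s)\big)\,\tau.$$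
   Context: Trees and forests. $\mathcal T$ is the set of finite (non-planar) rooted trees with vertices labelled by $\{1,\dots,d\}$, together with the empty tree $\mathbf 1$; $\mathcal F$ is the set of forests, i.e. finite commutative products (repetitions allowed) of nonempty labelled trees, the empty product being $\mathbf 1$. $|f|$ is the number of vertices of $f$; $\mathcal F_n=\{f\in\mathcal F:|f|\le n\}$. $[f]_a$ is the tree obtained by joining the roots of all trees in $f$ to a new root labelled $a$. Hopf algebra. $\mathcal H$ is the real vector space with basis $\mathcal F$ and the commutative product of forests. The coproduct $\Delta$ is the algebra morphism with $\Delta\mathbf 1=\mathbf 1\otimes\mathbf 1$ and $\Delta[f]_a=[f]_a\otimes\mathbf 1+(\mathrm{id}\otimes[\cdot]_a)\Delta f$. For linear functionals $x,y$ on $\mathcal H$, $\langle x\star y,h\rangle=\langle x\otimes y,\Delta h\rangle$. $G_N$ is the group (under $\star$) of characters (unital real-valued algebra homomorphisms) of $\mathcal H$, modulo identification of characters agreeing on $\mathcal F_N$. Branched rough path. A $\gamma$-Hölder branched rough path is a map $\mathbf X:[0,T]\to G_N$ such that, with $\mathbf X_{st}:=\mathbf X_s^{-1}\star\mathbf X_t$, $\sup_{0\le s<t\le T}|\langle\mathbf X_{st},f\rangle|/|t-s|^{\gamma|f|}<\infty$ for all $f\in\mathcal F_N$. Tensor notation. A tree shape $\tau$ is an unlabelled rooted tree, with a fixed enumeration of its vertices; a multi-index $(a_1,\dots,a_{|\tau|})\in\{1,\dots,d\}^{|\tau|}$ then determines a labelled tree $\tau_{a_1\dots a_{|\tau|}}$.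 An identity $\mathbf Z=\mathbf 1+\sum_\tau g^\tau\tau$ in $G_N$, with $g^\tau\in(\mathbb R^d)^{\otimes|\tau|}$ and the sum over a set of shapes, means: $\langle\mathbf Z,\mathbf 1\rangle=1$, $\langle\mathbf Z,\tau_{a_1\dots a_{|\tau|}}\rangle$ equals the $(a_1,\dots,a_{|\tau|})$-coordinate of $g^\tau$ for every shape $\tau$ in the sum and every multi-index, and $\langle\mathbf Z,h\rangle=0$ for all other forests $h$ with $1\le|h|\le N$. $C^\beta$, $0<\beta\le1$, denotes $\beta$-Hölder continuous functions (Lipschitz if $\beta=1$). *)

theory Defs
  imports
    "HOL-Library.Multiset"
    "HOL-Library.Poly_Mapping"
    "HOL-Analysis.Analysis"
    "HOL-Analysis.Finite_Function_Topology"
    "HOL-Algebra.Group"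
begin

text \<open>Non-planar rooted trees; a forest is a multiset of (nonempty) trees, the empty multiset playing
  the role of the unit \<open>\<one>\<close>, i.e. of the empty tree. Labels range over a type, a finite
  one when it stands for \<open>{1,\<dots>,d}\<close>; unlabelled shapes are trees with labels in \<^typ>\<open>unit\<close>.\<close>

datatype 'a rtree = Node 'a "'a rtree multiset"

type_synonym 'a forest = "'a rtree multiset"
type_synonym shape = "unit rtree"

primrec tree_size :: "'a rtree \<Rightarrow> nat" where
  "tree_size (Node a F) = Suc (\<Sum>\<^sub># (image_mset tree_size F))"

definition forest_size :: "'a forest \<Rightarrow> nat" where
  "forest_size F = (\<Sum>t\<in>#F. tree_size t)"

definition shape_of :: "'a rtree \<Rightarrow> shape" where
  "shape_of = map_rtree (\<lambda>_. ())"

text \<open>The multiplication of \<^typ>\<open>'k \<Rightarrow>\<^sub>0 real\<close> is convolution with respect to addition of the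
  indices. For forests the sum of indices is the multiset union, so that \<open>hopf\<close> carries the forest
  product; for pairs of forests it is the componentwise union, so that \<open>hopf2\<close> (the vector
  space with basis \<open>f \<otimes> g\<close>) carries the product of the tensor product algebra.\<close>

type_synonym 'a hopf = "'a forest \<Rightarrow>\<^sub>0 real"
type_synonym 'a hopf2 = "('a forest \<times> 'a forest) \<Rightarrow>\<^sub>0 real"

abbreviation basis :: "'k \<Rightarrow> 'k \<Rightarrow>\<^sub>0 real" where
  "basis k \<equiv> Poly_Mapping.single k 1"

definition linear_ext :: "('k \<Rightarrow> 'v::real_vector) \<Rightarrow> ('k \<Rightarrow>\<^sub>0 real) \<Rightarrow> 'v" where
  "linear_ext \<phi> u = (\<Sum>k\<in>Poly_Mapping.keys u. Poly_Mapping.lookup u k *\<^sub>R \<phi> k)"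

lemma linear_ext_superset:
  assumes "finite K" "Poly_Mapping.keys u \<subseteq> K"
  shows "linear_ext \<phi> u = (\<Sum>k\<in>K. Poly_Mapping.lookup u k *\<^sub>R \<phi> k)"
  unfolding linear_ext_def using assms
  by (intro sum.mono_neutral_left) (auto simp: in_keys_iff)

lemma lookup_scaleR_pm: "Poly_Mapping.lookup (r *\<^sub>R u) k = r *\<^sub>R Poly_Mapping.lookup u k"
  for u :: "'k \<Rightarrow>\<^sub>0 real"
proof -
  have "finite {x. r * Poly_Mapping.lookup u x \<noteq> 0}"
    by (rule finite_subset[of _ "Poly_Mapping.keys u"]) (auto simp: in_keys_iff)
  then show ?thesis by (simp add: scaleR_poly_mapping_def)
qed

lemma linear_linear_ext:
  fixes \<phi> :: "'k \<Rightarrow> 'v::real_vector"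
  shows "linear (linear_ext \<phi>)"
proof (rule linearI)
  fix u v :: "'k \<Rightarrow>\<^sub>0 real"
  let ?K = "Poly_Mapping.keys u \<union> Poly_Mapping.keys v"
  have "Poly_Mapping.keys (u + v) \<subseteq> ?K" by (rule Poly_Mapping.keys_add)
  then show "linear_ext \<phi> (u + v) = linear_ext \<phi> u + linear_ext \<phi> v"
    by (simp add: linear_ext_superset[of ?K] lookup_add scaleR_left_distrib sum.distrib)
next
  fix r :: real and u :: "'k \<Rightarrow>\<^sub>0 real"
  have "Poly_Mapping.keys (r *\<^sub>R u) \<subseteq> Poly_Mapping.keys u"
    by (auto simp: in_keys_iff lookup_scaleR_pm)
  then show "linear_ext \<phi> (r *\<^sub>R u) = r *\<^sub>R linear_ext \<phi> u"
    by (simp add: linear_ext_superset[of "Poly_Mapping.keys u"] lookup_scaleR_pm scaleR_sum_right)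
qed

lemma linear_ext_basis [simp]: "linear_ext \<phi> (basis k) = \<phi> k"
  by (simp add: linear_ext_def)

lemma pm_expand: "u = (\<Sum>k\<in>Poly_Mapping.keys u. Poly_Mapping.lookup u k *\<^sub>R basis k)"
  for u :: "'k \<Rightarrow>\<^sub>0 real"
  by (rule poly_mapping_eqI)
    (simp add: lookup_sum lookup_scaleR_pm lookup_single when_def in_keys_iff sum.delta' if_distrib[of "\<lambda>x. _ * x"] cong: if_cong)

lemma scaleR_mult_pm: "(r *\<^sub>R u) * v = r *\<^sub>R (u * v)" "u * (r *\<^sub>R v) = r *\<^sub>R (u * v)"
  for u v :: "'k::comm_monoid_add \<Rightarrow>\<^sub>0 real"
proof -
  have eq: "r *\<^sub>R w = Poly_Mapping.single 0 r * w" for w :: "'k \<Rightarrow>\<^sub>0 real"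
    unfolding mult_map_scale_conv_mult[symmetric]
    by (rule poly_mapping_eqI) (auto simp: lookup_scaleR_pm map.rep_eq when_def)
  show "(r *\<^sub>R u) * v = r *\<^sub>R (u * v)" "u * (r *\<^sub>R v) = r *\<^sub>R (u * v)"
    by (simp_all add: eq mult_ac)
qed

definition id_tensor_graft :: "'a \<Rightarrow> 'a hopf2 \<Rightarrow> 'a hopf2" where
  "id_tensor_graft a = linear_ext (\<lambda>(f, g). basis (f, {#Node a g#}))"

primrec coproduct_tree :: "'a rtree \<Rightarrow> 'a hopf2" where
  "coproduct_tree (Node a F) = basis ({#Node a F#}, {#}) +
     id_tensor_graft a (\<Prod>\<^sub># (image_mset coproduct_tree F))"

definition coproduct :: "'a hopf \<Rightarrow> 'a hopf2" where
  "coproduct = linear_ext (\<lambda>F. \<Prod>t\<in>#F. coproduct_tree t)"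

text \<open>The defining properties of the coproduct; it is linear by \<open>linear_linear_ext\<close>.\<close>

lemma coproduct_one: "coproduct (1 :: 'a hopf) = 1"
proof -
  have "coproduct (basis (0 :: 'a forest)) = (1 :: 'a hopf2)"
    unfolding coproduct_def by (simp only: linear_ext_basis) simp
  then show ?thesis by (simp only: single_one)
qed

lemma coproduct_mult: "coproduct (h * k) = coproduct h * coproduct k"
proof -
  have lin: "linear coproduct" unfolding coproduct_def by (rule linear_linear_ext)
  have b: "coproduct (basis f * basis g) = coproduct (basis f) * coproduct (basis g)" for f g :: "'a forest"
    by (simp add: mult_single coproduct_def)
  have s: "coproduct (basis f * k) = coproduct (basis f) * coproduct k" for f
    by (subst (1 2) pm_expand[of k])
      (simp add: sum_distrib_left scaleR_mult_pm linear_sum[OF lin] linear_cmul[OF lin] b)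
  show ?thesis
    by (subst (1 2) pm_expand[of h])
      (simp add: sum_distrib_right scaleR_mult_pm linear_sum[OF lin] linear_cmul[OF lin] s)
qed

lemma coproduct_graft:
  "coproduct (basis {#Node a F#}) =
     basis ({#Node a F#}, {#}) + id_tensor_graft a (coproduct (basis F))"
  by (simp add: coproduct_def)

text \<open>\<open>tensor_fun x y\<close> is the functional \<open>x \<otimes> y\<close> for linear \<open>x\<close> and \<open>y\<close>.\<close>

definition tensor_fun :: "('a hopf \<Rightarrow> real) \<Rightarrow> ('a hopf \<Rightarrow> real) \<Rightarrow> 'a hopf2 \<Rightarrow> real" where
  "tensor_fun x y = linear_ext (\<lambda>(f, g). x (basis f) * y (basis g))"

definition star :: "('a hopf \<Rightarrow> real) \<Rightarrow> ('a hopf \<Rightarrow> real) \<Rightarrow> 'a hopf \<Rightarrow> real"  (infixl \<open>\<star>\<close> 70) where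
  "(x \<star> y) h = tensor_fun x y (coproduct h)"

definition characters :: "('a hopf \<Rightarrow> real) set" where
  "characters = {x. linear x \<and> x 1 = 1 \<and> (\<forall>h k. x (h * k) = x h * x k)}"

definition counit :: "'a hopf \<Rightarrow> real" where
  "counit h = Poly_Mapping.lookup h {#}"

definition agree :: "nat \<Rightarrow> (('a hopf \<Rightarrow> real) \<times> ('a hopf \<Rightarrow> real)) set" where
  "agree N = {(x, y). x \<in> characters \<and> y \<in> characters \<and>
     (\<forall>f. forest_size f \<le> N \<longrightarrow> x (basis f) = y (basis f))}"

text \<open>\<open>G\<^sub>N\<close>: the elements are the classes of characters modulo \<^term>\<open>agree N\<close>.\<close>

definition butcher_group :: "nat \<Rightarrow> ('a hopf \<Rightarrow> real) set monoid" where
  "butcher_group N = \<lparr>carrier = characters // agree N,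
     mult = (\<lambda>A B. \<Union>x\<in>A. \<Union>y\<in>B. agree N `` {x \<star> y}),
     one = agree N `` {counit}\<rparr>"

text \<open>\<open>\<langle>Z, f\<rangle>\<close> for \<open>Z \<in> G\<^sub>N\<close>: the common value of the representatives of the class \<open>Z\<close>;
  meaningful when \<open>f\<close> has at most \<open>N\<close> vertices.\<close>

definition pairing :: "('a hopf \<Rightarrow> real) set \<Rightarrow> 'a forest \<Rightarrow> real" where
  "pairing Z f = (THE c. \<forall>x\<in>Z. x (basis f) = c)"

definition increment ::
    "nat \<Rightarrow> (real \<Rightarrow> ('a hopf \<Rightarrow> real) set) \<Rightarrow> real \<Rightarrow> real \<Rightarrow> ('a hopf \<Rightarrow> real) set" where
  "increment N X s t = inv\<^bsub>butcher_group N\<^esub> (X s) \<otimes>\<^bsub>butcher_group N\<^esub> X t"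

definition branched_rough_path ::
    "real \<Rightarrow> nat \<Rightarrow> real \<Rightarrow> (real \<Rightarrow> ('a hopf \<Rightarrow> real) set) \<Rightarrow> bool" where
  "branched_rough_path \<gamma> N T X \<longleftrightarrow>
     (\<forall>t\<in>{0..T}. X t \<in> carrier (butcher_group N)) \<and>
     (\<forall>f. forest_size f \<le> N \<longrightarrow>
        bdd_above {\<bar>pairing (increment N X s t) f\<bar> / \<bar>t - s\<bar> powr (\<gamma> * real (forest_size f)) |
          s t. 0 \<le> s \<and> s < t \<and> t \<le> T})"

text \<open>An element of \<open>(\<real>\<^sup>d)\<^sup>\<otimes>\<^sup>n\<close> is given by its coordinates, indexed by the multi-indices
  (lists) of length \<open>n\<close> and set to 0 on all other lists.\<close>

type_synonym 'a tensor = "'a list \<Rightarrow> real"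

definition tensors :: "nat \<Rightarrow> 'a tensor set" where
  "tensors n = {g. \<forall>a. length a \<noteq> n \<longrightarrow> g a = 0}"

definition tensor_norm :: "nat \<Rightarrow> 'a::finite tensor \<Rightarrow> real" where
  "tensor_norm n g = L2_set g {a. length a = n}"

definition holder_tensor_paths :: "real \<Rightarrow> real \<Rightarrow> nat \<Rightarrow> (real \<Rightarrow> 'a::finite tensor) set" where
  "holder_tensor_paths \<beta> T n = {f. (\<forall>t\<in>{0..T}. f t \<in> tensors n) \<and>
     (\<exists>C. \<forall>s\<in>{0..T}. \<forall>t\<in>{0..T}. tensor_norm n (f t - f s) \<le> C * \<bar>t - s\<bar> powr \<beta>)}"

text \<open>An enumeration of the vertices of a shape with \<open>n\<close> vertices is encoded as a tree of that shape
  whose vertices are labelled by their numbers: since the set of labels is \<open>{0,\<dots>,n-1}\<close>, each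
  number labels exactly one vertex. Replacing number \<open>i\<close> by the \<open>i\<close>-th entry of a multi-index
  gives the labelled tree that the multi-index determines.\<close>

definition vertex_enumeration :: "(shape \<Rightarrow> nat rtree) \<Rightarrow> bool" where
  "vertex_enumeration e \<longleftrightarrow>
     (\<forall>\<tau>. shape_of (e \<tau>) = \<tau> \<and> set_rtree (e \<tau>) = {..<tree_size \<tau>})"

definition labelled :: "(shape \<Rightarrow> nat rtree) \<Rightarrow> shape \<Rightarrow> 'a list \<Rightarrow> 'a rtree" where
  "labelled e \<tau> a = map_rtree (\<lambda>i. a ! i) (e \<tau>)"

lemma shape_of_Node: "shape_of (Node a F) = Node () (image_mset shape_of F)"
  by (simp add: shape_of_def)

lemma ex_enumerated_tree:
  "\<exists>t. shape_of t = \<tau> \<and> set_rtree t = {m..<m + tree_size \<tau>}"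
proof (induction \<tau> arbitrary: m)
  case (Node u S)
  have "\<exists>G. image_mset shape_of G = S \<and> (\<Union>t\<in>set_mset G. set_rtree t) = {k..<k + (\<Sum>t\<in>#S. tree_size t)}" for k
    using Node
  proof (induction S arbitrary: k)
    case empty
    show ?case by simp
  next
    case (add \<sigma> S)
    obtain t where t: "shape_of t = \<sigma>" "set_rtree t = {k..<k + tree_size \<sigma>}"
      using add.prems[of \<sigma> k] by auto
    have "\<exists>t. shape_of t = \<rho> \<and> set_rtree t = {m..<m + tree_size \<rho>}" if "\<rho> \<in># S" for \<rho> m
      using add.prems[of \<rho> m] that by auto
    from add.IH[OF this, of "k + tree_size \<sigma>"]
    obtain G where G: "image_mset shape_of G = S"
      "(\<Union>t\<in>set_mset G. set_rtree t) = {k + tree_size \<sigma>..<k + tree_size \<sigma> + (\<Sum>t\<in>#S. tree_size t)}"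
      by blast
    show ?case
      by (rule exI[of _ "add_mset t G"]) (use t G in auto)
  qed
  then obtain G where G: "image_mset shape_of G = S"
    "(\<Union>t\<in>set_mset G. set_rtree t) = {Suc m..<Suc m + (\<Sum>t\<in>#S. tree_size t)}" by blast
  show ?case
    by (rule exI[of _ "Node m G"]) (use G in \<open>auto simp: shape_of_Node\<close>)
qed

lemma vertex_enumeration_exists: "\<exists>e. vertex_enumeration e"
  unfolding vertex_enumeration_def using ex_enumerated_tree[where m = 0]
  by (simp add: lessThan_atLeast0) (rule choice, blast)

text \<open>The identity \<open>Z = \<one> + (\<Sum>\<tau>\<in>S. g \<tau> \<tau>)\<close> in \<open>G\<^sub>N\<close>.\<close>

definition has_expansion ::
    "nat \<Rightarrow> (shape \<Rightarrow> nat rtree) \<Rightarrow> shape set \<Rightarrow> ('a hopf \<Rightarrow> real) set \<Rightarrow> (shape \<Rightarrow> 'a tensor) \<Rightarrow> bool" where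
  "has_expansion N e S Z g \<longleftrightarrow>
     Z \<in> carrier (butcher_group N) \<and>
     pairing Z {#} = 1 \<and>
     (\<forall>\<tau>\<in>S. \<forall>a. length a = tree_size \<tau> \<longrightarrow> pairing Z {#labelled e \<tau> a#} = g \<tau> a) \<and>
     (\<forall>h. 1 \<le> forest_size h \<and> forest_size h \<le> N \<and>
          (\<nexists>\<tau> a. \<tau> \<in> S \<and> length a = tree_size \<tau> \<and> h = {#labelled e \<tau> a#}) \<longrightarrow>
        pairing Z h = 0)"

definition high_shapes :: "nat \<Rightarrow> shape set" where
  "high_shapes N = {\<tau>. N div 2 < tree_size \<tau> \<and> tree_size \<tau> \<le> N}"

end

theory Submission
  imports Defs
begin

text \<open>
  For a nonempty forest \<open>F\<close> the coproduct is \<open>F \<otimes> \<one> + \<one> \<otimes> F\<close> plus terms \<open>f \<otimes> g\<close> in which both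
  \<open>f\<close> and \<open>g\<close> are nonempty and \<open>|f| + |g| = |F|\<close>. If \<open>|F| \<le> N\<close>, one of the two factors of such a term
  has at most \<open>N div 2\<close> vertices. On characters that vanish on these small nonempty forests the product
  \<open>\<star>\<close> is therefore addition, up to degree \<open>N\<close> (\<open>star_basis_additive\<close>): inverses are given by a change
  of sign (\<open>inv_class\<close>), and \<open>\<langle>X\<^sub>s\<inverse> \<star> X\<^sub>t, F\<rangle> = \<langle>X\<^sub>t, F\<rangle> - \<langle>X\<^sub>s, F\<rangle>\<close> for nonempty \<open>F\<close>
  (\<open>pairing_increment\<close>).

  By multiplicativity \<open>X\<^sub>t\<close> also vanishes on every forest of at most \<open>N\<close> vertices that
  has at least two trees, because one of them is small. So the only data in \<open>X\<close> are the values
  on trees with more than \<open>N div 2\<close> vertices. The bound that defines a branched rough path is,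
  on such a tree, the Hoelder condition on its coordinate, and on all other nonempty forests it is
  trivial. The tensor-valued coordinates of a shape capture all these trees, because every
  labelling of a shape arises from a multi-index (\<open>labelled_surj\<close>).
\<close>

section \<open>Characters\<close>

lemma linear_ext_mult:
  fixes \<phi> :: "'k::comm_monoid_add \<Rightarrow> real"
  assumes "\<And>k l. \<phi> (k + l) = \<phi> k * \<phi> l"
  shows "linear_ext \<phi> (u * v) = linear_ext \<phi> u * linear_ext \<phi> v"
proof -
  have lin: "linear (linear_ext \<phi>)" by (rule linear_linear_ext)
  have b: "linear_ext \<phi> (basis k * basis l) = linear_ext \<phi> (basis k) * linear_ext \<phi> (basis l)" for k l
    by (simp add: mult_single assms)
  have s: "linear_ext \<phi> (basis k * v) = linear_ext \<phi> (basis k) * linear_ext \<phi> v" for k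
    by (subst (1 2) pm_expand[of v])
      (simp add: sum_distrib_left scaleR_mult_pm linear_sum[OF lin] linear_cmul[OF lin] b mult.left_commute
        del: linear_ext_basis)
  show ?thesis
    by (subst (1 2) pm_expand[of u])
      (simp add: sum_distrib_right scaleR_mult_pm linear_sum[OF lin] linear_cmul[OF lin] s mult.assoc)
qed

lemma linear_ext_one:
  fixes \<phi> :: "'k::comm_monoid_add \<Rightarrow> real"
  shows "linear_ext \<phi> 1 = \<phi> 0"
  by (simp flip: single_one)

lemma linear_ext_character:
  fixes \<phi> :: "'a forest \<Rightarrow> real"
  assumes "\<phi> {#} = 1" "\<And>F G. \<phi> (F + G) = \<phi> F * \<phi> G"
  shows "linear_ext \<phi> \<in> characters"
  using assms by (simp add: characters_def linear_linear_ext linear_ext_mult linear_ext_one)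

lemma counit_eq_linear_ext: "counit = linear_ext (\<lambda>F. if F = {#} then 1 else 0)"
proof
  fix h :: "'a hopf"
  show "counit h = linear_ext (\<lambda>F. if F = {#} then 1 else 0) h"
    by (simp add: counit_def linear_ext_def in_keys_iff if_distrib[of "\<lambda>x. _ * x"] sum.delta cong: if_cong)
qed

lemma counit_basis: "counit (basis F) = (if F = {#} then 1 else 0)"
  by (simp add: counit_eq_linear_ext)

lemma counit_character: "counit \<in> characters"
  unfolding counit_eq_linear_ext by (rule linear_ext_character) auto

lemma character_one: "x \<in> characters \<Longrightarrow> x 1 = 1"
  by (simp add: characters_def)

lemma character_add:
  "x \<in> characters \<Longrightarrow> x (basis (F + G)) = x (basis F) * x (basis G)"
  using mult_single[of F "1 :: real" G 1] by (simp add: characters_def) metis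

lemma character_add_mset:
  "x \<in> characters \<Longrightarrow> x (basis (add_mset \<sigma> F)) = x (basis {#\<sigma>#}) * x (basis F)"
  using character_add[of x "{#\<sigma>#}" F] by (simp only: add_mset_add_single[of \<sigma> F] add.commute)

lemma tree_size_pos: "0 < tree_size \<sigma>"
  by (cases \<sigma>) simp

lemma forest_size_simps [simp]:
  "forest_size {#} = 0"
  "forest_size (add_mset \<sigma> F) = tree_size \<sigma> + forest_size F"
  "forest_size (F + G) = forest_size F + forest_size G"
  by (simp_all add: forest_size_def)

lemma forest_size_eq_0 [simp]: "forest_size F = 0 \<longleftrightarrow> F = {#}"
  by (cases F) (use tree_size_pos in auto)

definition vanishes_upto :: "nat \<Rightarrow> ('a hopf \<Rightarrow> real) \<Rightarrow> bool" where
  "vanishes_upto m x \<longleftrightarrow> (\<forall>F. F \<noteq> {#} \<longrightarrow> forest_size F \<le> m \<longrightarrow> x (basis F) = 0)"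

lemma vanishes_uptoI:
  assumes x: "x \<in> characters" and "\<And>\<sigma>. tree_size \<sigma> \<le> m \<Longrightarrow> x (basis {#\<sigma>#}) = 0"
  shows "vanishes_upto m x"
  unfolding vanishes_upto_def
proof (intro allI impI)
  fix F :: "'a forest" assume F: "F \<noteq> {#}" "forest_size F \<le> m"
  then obtain \<sigma> G where "F = add_mset \<sigma> G" by (cases F) auto
  with F assms(2)[of \<sigma>] show "x (basis F) = 0" by (simp add: character_add_mset[OF x, of \<sigma> G])
qed

text \<open>Of two or more trees with at most \<open>N\<close> vertices in total, the smallest has at most \<open>N div 2\<close>.\<close>

lemma vanishes_on_products:
  assumes x: "x \<in> characters" and v: "vanishes_upto (N div 2) x"
    and F: "F \<noteq> {#}" "forest_size F \<le> N" "\<nexists>\<sigma>. F = {#\<sigma>#}"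
  shows "x (basis F) = 0"
proof -
  obtain \<sigma> G where G: "F = add_mset \<sigma> G" using F(1) by (cases F) auto
  with F(3) obtain \<rho> H where H: "G = add_mset \<rho> H" by (cases G) auto
  have "tree_size \<sigma> \<le> N div 2 \<or> tree_size \<rho> \<le> N div 2" using F(2) G H by simp linarith
  then have "x (basis {#\<sigma>#}) = 0 \<or> x (basis {#\<rho>#}) = 0"
    using v by (auto simp: vanishes_upto_def)
  then show ?thesis
    unfolding G character_add_mset[OF x, of \<sigma> G] unfolding H character_add_mset[OF x, of \<rho> H] by auto
qed

section \<open>The coproduct of a forest\<close>

text \<open>The coproduct of every forest is built from the unit by products and grafting. What is stable under
  these two operations, here the grading and the two leading terms, holds for all forests.\<close>

lemma coproduct_forest_induct:
  assumes empty: "Q {#} 1"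
    and add: "\<And>F G u v. Q F u \<Longrightarrow> Q G v \<Longrightarrow> Q (F + G) (u * v)"
    and graft: "\<And>a F u. Q F u \<Longrightarrow> Q {#Node a F#} (basis ({#Node a F#}, {#}) + id_tensor_graft a u)"
  shows "Q F (coproduct (basis F))"
proof -
  have forest: "Q F (\<Prod>t\<in>#F. coproduct_tree t)" if "\<And>t. t \<in># F \<Longrightarrow> Q {#t#} (coproduct_tree t)" for F
    using that
  proof (induction F)
    case (add t F)
    then show ?case using assms(2)[of "{#t#}" "coproduct_tree t" F] by auto
  qed (simp add: empty)
  have "Q {#t#} (coproduct_tree t)" for t
    by (induction t) (auto intro!: graft forest)
  with forest show ?thesis by (simp add: coproduct_def)
qed

lemma keys_mult_cases:
  assumes "k \<in> Poly_Mapping.keys (u * v)"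
  obtains i j where "i \<in> Poly_Mapping.keys u" "j \<in> Poly_Mapping.keys v" "k = i + j"
  using assms keys_mult[of u v] by auto

lemma keys_add_cases:
  assumes "k \<in> Poly_Mapping.keys (u + v)"
  shows "k \<in> Poly_Mapping.keys u \<or> k \<in> Poly_Mapping.keys v"
  using assms Poly_Mapping.keys_add[of u v] by auto

lemma keys_diff_cases:
  fixes u v :: "'k \<Rightarrow>\<^sub>0 real"
  assumes "k \<in> Poly_Mapping.keys (u - v)"
  shows "k \<in> Poly_Mapping.keys u \<or> k \<in> Poly_Mapping.keys v"
  using assms keys_diff[of u v] by auto

lemma keys_id_tensor_graft:
  assumes "k \<in> Poly_Mapping.keys (id_tensor_graft a u)"
  obtains f g where "(f, g) \<in> Poly_Mapping.keys u" "k = (f, {#Node a g#})"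
proof -
  have "k \<in> (\<Union>i\<in>Poly_Mapping.keys u. Poly_Mapping.keys
      (Poly_Mapping.lookup u i *\<^sub>R (case i of (f, g) \<Rightarrow> basis (f, {#Node a g#}))))"
    using assms unfolding id_tensor_graft_def linear_ext_def by (rule subsetD[OF keys_sum])
  then obtain f g where "(f, g) \<in> Poly_Mapping.keys u"
      "k \<in> Poly_Mapping.keys (Poly_Mapping.lookup u (f, g) *\<^sub>R basis (f, {#Node a g#}))"
    by auto
  then show thesis
    by (intro that[of f g]) (auto simp: in_keys_iff lookup_scaleR_pm lookup_single when_def split: if_splits)
qed

lemma id_tensor_graft_add: "id_tensor_graft a (u + v) = id_tensor_graft a u + id_tensor_graft a v"
  unfolding id_tensor_graft_def by (rule linear_add[OF linear_linear_ext])

lemma id_tensor_graft_basis: "id_tensor_graft a (basis (f, g)) = basis (f, {#Node a g#})"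
  by (simp add: id_tensor_graft_def)

lemma coproduct_graded:
  fixes F :: "'a forest"
  assumes "k \<in> Poly_Mapping.keys (coproduct (basis F))"
  shows "forest_size (fst k) + forest_size (snd k) = forest_size F"
proof -
  have "\<forall>k\<in>Poly_Mapping.keys (coproduct (basis F)). forest_size (fst k) + forest_size (snd k) = forest_size F"
  proof (rule coproduct_forest_induct)
    fix a and F :: "'a forest" and u :: "'a hopf2"
    assume "\<forall>k\<in>Poly_Mapping.keys u. forest_size (fst k) + forest_size (snd k) = forest_size F"
    then show "\<forall>k\<in>Poly_Mapping.keys (basis ({#Node a F#}, {#}) + id_tensor_graft a u).
        forest_size (fst k) + forest_size (snd k) = forest_size {#Node a F#}"
      by (auto dest!: keys_add_cases elim!: keys_id_tensor_graft simp: forest_size_def)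
  qed (fastforce elim!: keys_mult_cases simp: zero_prod_def)+
  with assms show ?thesis by blast
qed

text \<open>The tensors \<open>f \<otimes> g\<close> with \<open>g\<close> nonempty span an ideal, so the leading term \<open>F \<otimes> \<one>\<close> of a product
  is the product of the leading terms. The same holds on the other side for \<open>f\<close> nonempty.\<close>

lemma coproduct_left_term:
  "\<exists>r. coproduct (basis F) = basis (F, {#}) + r \<and> (\<forall>k\<in>Poly_Mapping.keys r. snd k \<noteq> {#})"
  for F :: "'a forest"
proof (rule coproduct_forest_induct[where Q =
      "\<lambda>F u. \<exists>r. u = basis (F, {#}) + r \<and> (\<forall>k\<in>Poly_Mapping.keys r. snd k \<noteq> {#})"])
  show "\<exists>r. (1 :: 'a hopf2) = basis ({#}, {#}) + r \<and> (\<forall>k\<in>Poly_Mapping.keys r. snd k \<noteq> {#})"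
    by (rule exI[of _ 0]) (simp flip: zero_prod_def)
next
  fix F G :: "'a forest" and u v :: "'a hopf2"
  assume "\<exists>r. u = basis (F, {#}) + r \<and> (\<forall>k\<in>Poly_Mapping.keys r. snd k \<noteq> {#})"
    "\<exists>r. v = basis (G, {#}) + r \<and> (\<forall>k\<in>Poly_Mapping.keys r. snd k \<noteq> {#})"
  then obtain r s where r: "u = basis (F, {#}) + r" "\<forall>k\<in>Poly_Mapping.keys r. snd k \<noteq> {#}"
    and s: "v = basis (G, {#}) + s" "\<forall>k\<in>Poly_Mapping.keys s. snd k \<noteq> {#}" by auto
  have "u * v = basis (F + G, {#}) + (basis (F, {#}) * s + r * v)"
    by (simp add: r(1) s(1) distrib_left distrib_right mult_single)
  moreover have "\<forall>k\<in>Poly_Mapping.keys (basis (F, {#}) * s + r * v). snd k \<noteq> {#}"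
    using r(2) s(2) by (fastforce dest!: keys_add_cases elim!: keys_mult_cases)
  ultimately show "\<exists>r. u * v = basis (F + G, {#}) + r \<and> (\<forall>k\<in>Poly_Mapping.keys r. snd k \<noteq> {#})"
    by blast
next
  fix a and F :: "'a forest" and u :: "'a hopf2"
  show "\<exists>r. basis ({#Node a F#}, {#}) + id_tensor_graft a u = basis ({#Node a F#}, {#}) + r
      \<and> (\<forall>k\<in>Poly_Mapping.keys r. snd k \<noteq> {#})"
    by (rule exI[of _ "id_tensor_graft a u"]) (auto elim!: keys_id_tensor_graft)
qed

lemma coproduct_right_term:
  "\<exists>r. coproduct (basis F) = basis ({#}, F) + r \<and> (\<forall>k\<in>Poly_Mapping.keys r. fst k \<noteq> {#})"
  for F :: "'a forest"
proof (rule coproduct_forest_induct[where Q =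
      "\<lambda>F u. \<exists>r. u = basis ({#}, F) + r \<and> (\<forall>k\<in>Poly_Mapping.keys r. fst k \<noteq> {#})"])
  show "\<exists>r. (1 :: 'a hopf2) = basis ({#}, {#}) + r \<and> (\<forall>k\<in>Poly_Mapping.keys r. fst k \<noteq> {#})"
    by (rule exI[of _ 0]) (simp flip: zero_prod_def)
next
  fix F G :: "'a forest" and u v :: "'a hopf2"
  assume "\<exists>r. u = basis ({#}, F) + r \<and> (\<forall>k\<in>Poly_Mapping.keys r. fst k \<noteq> {#})"
    "\<exists>r. v = basis ({#}, G) + r \<and> (\<forall>k\<in>Poly_Mapping.keys r. fst k \<noteq> {#})"
  then obtain r s where r: "u = basis ({#}, F) + r" "\<forall>k\<in>Poly_Mapping.keys r. fst k \<noteq> {#}"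
    and s: "v = basis ({#}, G) + s" "\<forall>k\<in>Poly_Mapping.keys s. fst k \<noteq> {#}" by auto
  have "u * v = basis ({#}, F + G) + (basis ({#}, F) * s + r * v)"
    by (simp add: r(1) s(1) distrib_left distrib_right mult_single)
  moreover have "\<forall>k\<in>Poly_Mapping.keys (basis ({#}, F) * s + r * v). fst k \<noteq> {#}"
    using r(2) s(2) by (fastforce dest!: keys_add_cases elim!: keys_mult_cases)
  ultimately show "\<exists>r. u * v = basis ({#}, F + G) + r \<and> (\<forall>k\<in>Poly_Mapping.keys r. fst k \<noteq> {#})"
    by blast
next
  fix a and F :: "'a forest" and u :: "'a hopf2"
  assume "\<exists>r. u = basis ({#}, F) + r \<and> (\<forall>k\<in>Poly_Mapping.keys r. fst k \<noteq> {#})"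
  then obtain r where r: "u = basis ({#}, F) + r" "\<forall>k\<in>Poly_Mapping.keys r. fst k \<noteq> {#}" by blast
  show "\<exists>r. basis ({#Node a F#}, {#}) + id_tensor_graft a u = basis ({#}, {#Node a F#}) + r
      \<and> (\<forall>k\<in>Poly_Mapping.keys r. fst k \<noteq> {#})"
    by (rule exI[of _ "basis ({#Node a F#}, {#}) + id_tensor_graft a r"])
      (use r in \<open>auto simp: id_tensor_graft_add id_tensor_graft_basis
        dest!: keys_add_cases elim!: keys_id_tensor_graft\<close>)
qed

lemma coproduct_expansion:
  assumes "F \<noteq> {#}"
  obtains w where "coproduct (basis F) = basis (F, {#}) + basis ({#}, F) + w"
    and "\<And>f g. (f, g) \<in> Poly_Mapping.keys w \<Longrightarrow>
      f \<noteq> {#} \<and> g \<noteq> {#} \<and> forest_size f + forest_size g = forest_size F"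
proof -
  obtain r where r: "coproduct (basis F) = basis (F, {#}) + r" "\<forall>k\<in>Poly_Mapping.keys r. snd k \<noteq> {#}"
    using coproduct_left_term by blast
  obtain s where s: "coproduct (basis F) = basis ({#}, F) + s" "\<forall>k\<in>Poly_Mapping.keys s. fst k \<noteq> {#}"
    using coproduct_right_term by blast
  define w where "w = r - basis ({#}, F)"
  have ws: "w = s - basis (F, {#})"
    using r(1) s(1) by (simp add: w_def algebra_simps)
  have wc: "w = coproduct (basis F) - (basis (F, {#}) + basis ({#}, F))"
    using r(1) by (simp add: w_def)
  show thesis
  proof
    show "coproduct (basis F) = basis (F, {#}) + basis ({#}, F) + w" by (simp add: wc)
  next
    fix f g assume k: "(f, g) \<in> Poly_Mapping.keys w"
    from k have "g \<noteq> {#}"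
      unfolding w_def using assms r(2) by (auto dest!: keys_diff_cases)
    moreover from k have "f \<noteq> {#}"
      unfolding ws using assms s(2) by (auto dest!: keys_diff_cases)
    moreover from k have "forest_size f + forest_size g = forest_size F"
      unfolding wc using coproduct_graded[of "(f, g)" F]
      by (auto dest!: keys_diff_cases keys_add_cases)
    ultimately show "f \<noteq> {#} \<and> g \<noteq> {#} \<and> forest_size f + forest_size g = forest_size F" by blast
  qed
qed

section \<open>The product of characters\<close>

lemma star_character:
  assumes "x \<in> characters" "y \<in> characters"
  shows "x \<star> y \<in> characters"
proof -
  let ?\<phi> = "\<lambda>(f, g). x (basis f) * y (basis g)"
  have mult: "?\<phi> (k + l) = ?\<phi> k * ?\<phi> l" for k l
    by (cases k; cases l) (simp add: character_add[OF assms(1)] character_add[OF assms(2)])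
  have "linear (\<lambda>h. linear_ext ?\<phi> (linear_ext (\<lambda>F. \<Prod>t\<in>#F. coproduct_tree t) h))"
    using linear_compose[OF linear_linear_ext linear_linear_ext] by (simp add: o_def)
  then have "linear (x \<star> y)"
    by (simp add: star_def[abs_def] tensor_fun_def coproduct_def)
  moreover have "(x \<star> y) 1 = 1"
    by (simp add: star_def tensor_fun_def coproduct_one linear_ext_one zero_prod_def
        character_one assms)
  moreover have "(x \<star> y) (h * k) = (x \<star> y) h * (x \<star> y) k" for h k
    by (simp only: star_def tensor_fun_def coproduct_mult linear_ext_mult[of ?\<phi>, OF mult])
  ultimately show ?thesis by (simp add: characters_def)
qed

text \<open>The truncation at degree \<open>N\<close> is compatible with \<open>\<star>\<close> because \<open>\<Delta> F\<close> involves no forest larger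
  than \<open>F\<close>.\<close>

lemma star_agree:
  assumes "(x, x') \<in> agree N" "(y, y') \<in> agree N"
  shows "(x \<star> y, x' \<star> y') \<in> agree N"
proof -
  have "(x \<star> y) (basis F) = (x' \<star> y') (basis F)" if F: "forest_size F \<le> N" for F
    unfolding star_def tensor_fun_def linear_ext_def
  proof (rule sum.cong[OF refl])
    fix k assume "k \<in> Poly_Mapping.keys (coproduct (basis F))"
    from coproduct_graded[OF this] F have "forest_size (fst k) \<le> N" "forest_size (snd k) \<le> N" by linarith+
    with assms show "Poly_Mapping.lookup (coproduct (basis F)) k *\<^sub>R (case k of (f, g) \<Rightarrow> x (basis f) * y (basis g))
      = Poly_Mapping.lookup (coproduct (basis F)) k *\<^sub>R (case k of (f, g) \<Rightarrow> x' (basis f) * y' (basis g))"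
      by (cases k) (simp add: agree_def)
  qed
  with assms show ?thesis by (simp add: agree_def star_character)
qed

text \<open>Only the products over the mixed terms are required to vanish, so that this applies when just one
  of the factors is known to vanish on small forests.\<close>

lemma star_basis:
  assumes x: "x \<in> characters" and y: "y \<in> characters" and F: "F \<noteq> {#}"
    and mixed: "\<And>f g. f \<noteq> {#} \<Longrightarrow> g \<noteq> {#} \<Longrightarrow> forest_size f + forest_size g = forest_size F
      \<Longrightarrow> x (basis f) * y (basis g) = 0"
  shows "(x \<star> y) (basis F) = x (basis F) + y (basis F)"
proof -
  let ?\<phi> = "\<lambda>(f, g). x (basis f) * y (basis g)"
  obtain w where w: "coproduct (basis F) = basis (F, {#}) + basis ({#}, F) + w"
    and kw: "\<And>f g. (f, g) \<in> Poly_Mapping.keys w \<Longrightarrow>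
      f \<noteq> {#} \<and> g \<noteq> {#} \<and> forest_size f + forest_size g = forest_size F"
    using coproduct_expansion[OF F] by metis
  have "linear_ext ?\<phi> w = 0"
    unfolding linear_ext_def by (rule sum.neutral) (use kw mixed in \<open>auto split: prod.split\<close>)
  then show ?thesis
    by (simp add: star_def tensor_fun_def w linear_add[OF linear_linear_ext] character_one x y)
qed

lemma star_basis_additive:
  assumes "x \<in> characters" "y \<in> characters"
    and v: "vanishes_upto (N div 2) x" "vanishes_upto (N div 2) y"
    and F: "F \<noteq> {#}" "forest_size F \<le> N"
  shows "(x \<star> y) (basis F) = x (basis F) + y (basis F)"
proof (rule star_basis)
  fix f g :: "'a forest"
  assume fg: "f \<noteq> {#}" "g \<noteq> {#}" "forest_size f + forest_size g = forest_size F"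
  with F(2) have "forest_size f \<le> N div 2 \<or> forest_size g \<le> N div 2" by linarith
  with fg v show "x (basis f) * y (basis g) = 0" by (auto simp: vanishes_upto_def)
qed (use assms in auto)

section \<open>The truncated group\<close>

lemma equiv_agree: "equiv characters (agree N)"
  by (rule equivI) (auto simp: agree_def refl_on_def sym_def trans_def)

lemma carrier_cases:
  assumes "Z \<in> carrier (butcher_group N)"
  obtains x where "x \<in> characters" "Z = agree N `` {x}"
  using assms by (auto simp: butcher_group_def elim!: quotientE)

lemma class_in_carrier: "x \<in> characters \<Longrightarrow> agree N `` {x} \<in> carrier (butcher_group N)"
  by (simp add: butcher_group_def quotientI)

lemma pairing_class:
  assumes "x \<in> characters" "forest_size F \<le> N"
  shows "pairing (agree N `` {x}) F = x (basis F)"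
  unfolding pairing_def
  by (rule the_equality) (use assms in \<open>auto simp: agree_def\<close>)

lemma class_eq_iff:
  assumes "x \<in> characters" "y \<in> characters"
  shows "agree N `` {x} = agree N `` {y} \<longleftrightarrow> (\<forall>F. forest_size F \<le> N \<longrightarrow> x (basis F) = y (basis F))"
  using eq_equiv_class_iff[OF equiv_agree assms, of N] assms by (simp add: agree_def)

lemma mult_class:
  assumes "x \<in> characters" "y \<in> characters"
  shows "agree N `` {x} \<otimes>\<^bsub>butcher_group N\<^esub> agree N `` {y} = agree N `` {x \<star> y}"
proof -
  have "congruent2 (agree N) (agree N) (\<lambda>x y. agree N `` {x \<star> y :: 'a hopf \<Rightarrow> real})"
  proof (rule congruent2I')
    fix x x' y y' :: "'a hopf \<Rightarrow> real"
    assume "(x, x') \<in> agree N" "(y, y') \<in> agree N"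
    then show "agree N `` {x \<star> y} = agree N `` {x' \<star> y'}"
      by (intro equiv_class_eq[OF equiv_agree] star_agree)
  qed
  from UN_equiv_class2[OF equiv_agree equiv_agree this assms] show ?thesis
    by (simp add: butcher_group_def)
qed

text \<open>An inverse arises by negating the values on trees. It is unique: if \<open>x \<star> z\<close> is the counit up to degree
  \<open>N\<close>, then on forests of at most \<open>N div 2\<close> vertices the mixed terms vanish because of \<open>x\<close> alone,
  hence \<open>z\<close> vanishes there as well; so the product is additive up to degree \<open>N\<close>, and \<open>z = - x\<close> on
  nonempty forests.\<close>

lemma inv_class:
  assumes x: "x \<in> characters" and v: "vanishes_upto (N div 2) x"
  obtains y where "y \<in> characters" "vanishes_upto (N div 2) y"
    "inv\<^bsub>butcher_group N\<^esub> (agree N `` {x}) = agree N `` {y}"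
    "\<And>F. F \<noteq> {#} \<Longrightarrow> forest_size F \<le> N \<Longrightarrow> y (basis F) = - x (basis F)"
proof -
  let ?G = "butcher_group N :: ('a hopf \<Rightarrow> real) set monoid"
  define y where "y = linear_ext (\<lambda>F. \<Prod>\<sigma>\<in>#F. - x (basis {#\<sigma>#}))"
  have y: "y \<in> characters"
    unfolding y_def by (rule linear_ext_character) auto
  have ytree: "y (basis {#\<sigma>#}) = - x (basis {#\<sigma>#})" for \<sigma>
    by (simp add: y_def)
  have vy: "vanishes_upto (N div 2) y"
    using v by (intro vanishes_uptoI[OF y]) (simp add: ytree vanishes_upto_def)
  have yF: "y (basis F) = - x (basis F)" if F: "F \<noteq> {#}" "forest_size F \<le> N" for F
  proof (cases "\<exists>\<sigma>. F = {#\<sigma>#}")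
    case False
    with F vanishes_on_products[OF x v, of F] vanishes_on_products[OF y vy, of F] show ?thesis by simp
  qed (auto simp: ytree)
  have one: "\<one>\<^bsub>?G\<^esub> = agree N `` {counit}" by (simp add: butcher_group_def)
  have xy: "(x \<star> y) (basis F) = counit (basis F)" "(y \<star> x) (basis F) = counit (basis F)"
    if "forest_size F \<le> N" for F
  proof -
    show "(x \<star> y) (basis F) = counit (basis F)"
      using that yF star_basis_additive[OF x y v vy, of F] star_character[OF x y]
      by (cases "F = {#}") (auto simp: counit_basis character_one counit_character)
    show "(y \<star> x) (basis F) = counit (basis F)"
      using that yF star_basis_additive[OF y x vy v, of F] star_character[OF y x]
      by (cases "F = {#}") (auto simp: counit_basis character_one counit_character)
  qed
  have "inv\<^bsub>?G\<^esub> (agree N `` {x}) = agree N `` {y}"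
    unfolding m_inv_def
  proof (rule the_equality)
    show "agree N `` {y} \<in> carrier ?G \<and> agree N `` {x} \<otimes>\<^bsub>?G\<^esub> agree N `` {y} = \<one>\<^bsub>?G\<^esub>
        \<and> agree N `` {y} \<otimes>\<^bsub>?G\<^esub> agree N `` {x} = \<one>\<^bsub>?G\<^esub>"
      using x y xy by (simp add: class_in_carrier mult_class one class_eq_iff star_character counit_character)
  next
    fix Z assume Z: "Z \<in> carrier ?G \<and> agree N `` {x} \<otimes>\<^bsub>?G\<^esub> Z = \<one>\<^bsub>?G\<^esub> \<and> Z \<otimes>\<^bsub>?G\<^esub> agree N `` {x} = \<one>\<^bsub>?G\<^esub>"
    then obtain z where z: "z \<in> characters" "Z = agree N `` {z}" by (auto elim: carrier_cases)
    with Z x have xz: "(x \<star> z) (basis F) = counit (basis F)" if "forest_size F \<le> N" for F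
      using that by (simp add: mult_class one class_eq_iff star_character counit_character)
    have "z (basis F) = 0" if F: "F \<noteq> {#}" "forest_size F \<le> N div 2" for F
    proof -
      have "x (basis F) = 0" using v F by (simp add: vanishes_upto_def)
      moreover have "(x \<star> z) (basis F) = x (basis F) + z (basis F)"
      proof (rule star_basis[OF x z(1) F(1)])
        fix f g :: "'a forest"
        assume "f \<noteq> {#}" "forest_size f + forest_size g = forest_size F"
        with F v show "x (basis f) * z (basis g) = 0" by (simp add: vanishes_upto_def)
      qed
      ultimately show ?thesis using xz[of F] F by (simp add: counit_basis)
    qed
    then have vz: "vanishes_upto (N div 2) z" by (simp add: vanishes_upto_def)
    have "z (basis F) = y (basis F)" if "forest_size F \<le> N" for F
      using that xz[of F] yF[of F] star_basis_additive[OF x z(1) v vz, of F]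
      by (cases "F = {#}") (auto simp: counit_basis character_one counit_character y z(1))
    then show "Z = agree N `` {y}" using z y by (simp add: class_eq_iff)
  qed
  with that y vy yF show thesis by blast
qed

definition trivial_upto :: "nat \<Rightarrow> ('a hopf \<Rightarrow> real) set \<Rightarrow> bool" where
  "trivial_upto m Z \<longleftrightarrow> (\<forall>\<sigma>. tree_size \<sigma> \<le> m \<longrightarrow> pairing Z {#\<sigma>#} = 0)"

lemma trivial_upto_cases:
  assumes Z: "Z \<in> carrier (butcher_group N)" and triv: "trivial_upto (N div 2) Z"
  obtains x where "x \<in> characters" "Z = agree N `` {x}" "vanishes_upto (N div 2) x"
proof -
  obtain x where x: "x \<in> characters" "Z = agree N `` {x}" using carrier_cases[OF Z] .
  have "x (basis {#\<sigma>#}) = 0" if \<sigma>: "tree_size \<sigma> \<le> N div 2" for \<sigma>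
  proof -
    have "forest_size {#\<sigma>#} \<le> N" using \<sigma> by simp
    then show ?thesis using pairing_class[OF x(1)] triv \<sigma> x(2) by (simp add: trivial_upto_def)
  qed
  with x show thesis by (intro that vanishes_uptoI)
qed

lemma pairing_empty: "Z \<in> carrier (butcher_group N) \<Longrightarrow> pairing Z {#} = 1"
  by (auto elim!: carrier_cases simp: pairing_class character_one)

lemma pairing_products_zero:
  assumes "Z \<in> carrier (butcher_group N)" "trivial_upto (N div 2) Z"
    and "F \<noteq> {#}" "forest_size F \<le> N" "\<nexists>\<sigma>. F = {#\<sigma>#}"
  shows "pairing Z F = 0"
proof -
  obtain x where "x \<in> characters" "Z = agree N `` {x}" "vanishes_upto (N div 2) x"
    using trivial_upto_cases[OF assms(1,2)] .
  with assms(3-) show ?thesis by (simp add: pairing_class vanishes_on_products)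
qed

lemma
  assumes "X s \<in> carrier (butcher_group N)" "trivial_upto (N div 2) (X s)"
    and "X t \<in> carrier (butcher_group N)" "trivial_upto (N div 2) (X t)"
  shows increment_in_carrier: "increment N X s t \<in> carrier (butcher_group N)"
    and pairing_increment: "\<And>F. F \<noteq> {#} \<Longrightarrow> forest_size F \<le> N \<Longrightarrow>
      pairing (increment N X s t) F = pairing (X t) F - pairing (X s) F"
proof -
  obtain x where x: "x \<in> characters" "X s = agree N `` {x}" "vanishes_upto (N div 2) x"
    using trivial_upto_cases[OF assms(1,2)] .
  obtain z where z: "z \<in> characters" "X t = agree N `` {z}" "vanishes_upto (N div 2) z"
    using trivial_upto_cases[OF assms(3,4)] .
  obtain y where y: "y \<in> characters" "vanishes_upto (N div 2) y"
    "inv\<^bsub>butcher_group N\<^esub> (agree N `` {x}) = agree N `` {y}"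
    "\<And>F. F \<noteq> {#} \<Longrightarrow> forest_size F \<le> N \<Longrightarrow> y (basis F) = - x (basis F)"
    using inv_class[OF x(1,3)] by blast
  have inc: "increment N X s t = agree N `` {y \<star> z}"
    by (simp add: increment_def x(2) y(3) z(2) mult_class y(1) z(1))
  show "increment N X s t \<in> carrier (butcher_group N)"
    by (simp add: inc class_in_carrier star_character y(1) z(1))
  show "pairing (increment N X s t) F = pairing (X t) F - pairing (X s) F"
    if "F \<noteq> {#}" "forest_size F \<le> N" for F
    using that by (simp add: inc x(1,2) z(1,2) y(4) pairing_class star_character[OF y(1) z(1)]
        star_basis_additive[OF y(1) z(1) y(2) z(3)])
qed

section \<open>Labelled trees and multi-indices\<close>

definition labels :: "'a forest \<Rightarrow> 'a set" where
  "labels F = \<Union>(set_rtree ` set_mset F)"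

lemma labels_simps [simp]:
  "labels {#} = {}" "labels (add_mset t F) = set_rtree t \<union> labels F"
  by (simp_all add: labels_def)

lemma finite_set_rtree [simp]: "finite (set_rtree t)"
  by (induction t) auto

lemma finite_labels [simp]: "finite (labels F)"
  by (simp add: labels_def)

lemma card_labels_le_if:
  assumes "\<And>t. t \<in># F \<Longrightarrow> card (set_rtree t) \<le> tree_size t"
  shows "card (labels F) \<le> forest_size F"
  using assms
proof (induction F)
  case (add t F)
  then have "card (labels F) \<le> forest_size F" "card (set_rtree t) \<le> tree_size t" by auto
  then show ?case using card_Un_le[of "set_rtree t" "labels F"] by simp
qed simp

lemma set_rtree_Node: "set_rtree (Node a F) = insert a (labels F)"
  by (simp add: labels_def)

lemma card_set_rtree_le: "card (set_rtree t) \<le> tree_size t"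
proof (induction t)
  case (Node a F)
  then have "card (labels F) \<le> forest_size F" by (rule card_labels_le_if)
  then show ?case unfolding set_rtree_Node by (simp add: forest_size_def card_insert_if)
qed

lemma card_labels_le: "card (labels F) \<le> forest_size F"
  by (rule card_labels_le_if) (rule card_set_rtree_le)

lemma tree_size_shape_of [simp]: "tree_size (shape_of t) = tree_size t"
proof (induction t)
  case (Node a F)
  then show ?case
    by (simp add: shape_of_Node image_mset.compositionality o_def cong: image_mset_cong)
qed

text \<open>As many labels as vertices means that the labels are distinct; then the subtrees of a vertex use
  disjoint sets of labels, and the relabellings found for them can be glued.\<close>

lemma relabelling_exists:
  fixes t :: "'a rtree" and \<sigma> :: "'b rtree"
  assumes "card (set_rtree t) = tree_size t" "shape_of \<sigma> = shape_of t"
  shows "\<exists>\<rho>. map_rtree \<rho> t = \<sigma>"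
  using assms
proof (induction t arbitrary: \<sigma>)
  case (Node a F)
  have forest: "\<exists>\<rho>. image_mset (map_rtree \<rho>) F = G"
    if "\<And>t (\<sigma> :: 'b rtree). t \<in># F \<Longrightarrow> card (set_rtree t) = tree_size t \<Longrightarrow> shape_of \<sigma> = shape_of t \<Longrightarrow> \<exists>\<rho>. map_rtree \<rho> t = \<sigma>"
      and "card (labels F) = forest_size F" "image_mset shape_of G = image_mset shape_of F" for G :: "'b forest"
    using that
  proof (induction F arbitrary: G)
    case empty
    then show ?case by simp
  next
    case (add t F)
    from add.prems(3) obtain \<sigma> H where G: "G = add_mset \<sigma> H" "shape_of \<sigma> = shape_of t"
        "image_mset shape_of H = image_mset shape_of F"
      by (auto dest!: msed_map_invR)
    have fin: "finite (set_rtree t)" "finite (labels F)" and le2: "card (set_rtree t) \<le> tree_size t" "card (labels F) \<le> forest_size F"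
      using card_labels_le[of F] card_set_rtree_le[of t] by auto
    have "card (set_rtree t \<union> labels F) + card (set_rtree t \<inter> labels F) = card (set_rtree t) + card (labels F)"
      using card_Un_Int[OF fin] by simp
    then have cards: "card (set_rtree t) = tree_size t" "card (labels F) = forest_size F"
      and "card (set_rtree t \<inter> labels F) = 0"
      using le2 add.prems(2) by (simp_all del: card_0_eq)
    then have disj: "set_rtree t \<inter> labels F = {}" using fin by simp
    obtain \<rho>1 where \<rho>1: "map_rtree \<rho>1 t = \<sigma>" using add.prems(1)[of t \<sigma>] cards G by auto
    obtain \<rho>2 where \<rho>2: "image_mset (map_rtree \<rho>2) F = H" using add.IH[of H] add.prems(1) cards G by auto
    let ?\<rho> = "\<lambda>i. if i \<in> set_rtree t then \<rho>1 i else \<rho>2 i"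
    have "map_rtree ?\<rho> t = \<sigma>" unfolding \<rho>1[symmetric] by (rule rtree.map_cong0) simp
    moreover have "image_mset (map_rtree ?\<rho>) F = H"
      unfolding \<rho>2[symmetric]
      by (rule image_mset_cong, rule rtree.map_cong0) (use disj in \<open>auto simp: labels_def\<close>)
    ultimately show ?case by (intro exI[of _ ?\<rho>]) (simp add: G)
  qed
  obtain b G where \<sigma>: "\<sigma> = Node b G" by (cases \<sigma>)
  have "card (insert a (labels F)) = Suc (forest_size F)" using Node.prems(1) by (simp only: set_rtree_Node) (simp add: forest_size_def)
  then have a: "a \<notin> labels F" and card: "card (labels F) = forest_size F"
    using card_labels_le[of F] by (auto simp: card_insert_if split: if_splits)
  obtain \<rho> where \<rho>: "image_mset (map_rtree \<rho>) F = G"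
    using forest[of G] Node.IH card Node.prems(2) by (auto simp: \<sigma> shape_of_Node)
  \<comment> \<open>the label of the root occurs nowhere else, so it can be sent to \<open>b\<close> independently\<close>
  have map: "image_mset (map_rtree (\<rho>(a := b))) F = G"
    unfolding \<rho>[symmetric] by (rule image_mset_cong, rule rtree.map_cong0) (use a in \<open>auto simp: labels_def\<close>)
  then show ?case by (intro exI[of _ "\<rho>(a := b)"]) (simp only: \<sigma> rtree.map fun_upd_same map)
qed

lemma shape_of_labelled: "vertex_enumeration e \<Longrightarrow> shape_of (labelled e \<tau> a) = \<tau>"
  by (simp add: vertex_enumeration_def labelled_def shape_of_def rtree.map_comp o_def)

lemma tree_size_labelled: "vertex_enumeration e \<Longrightarrow> tree_size (labelled e \<tau> a) = tree_size \<tau>"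
  by (metis shape_of_labelled tree_size_shape_of)

lemma labelled_surj:
  assumes e: "vertex_enumeration e"
  obtains a where "length a = tree_size \<sigma>" "labelled e (shape_of \<sigma>) a = \<sigma>"
proof -
  let ?t = "e (shape_of \<sigma>)"
  have t: "shape_of ?t = shape_of \<sigma>" "set_rtree ?t = {..<tree_size \<sigma>}"
    using e by (auto simp: vertex_enumeration_def)
  have "tree_size ?t = tree_size \<sigma>" using t(1) by (metis tree_size_shape_of)
  then obtain \<rho> where \<rho>: "map_rtree \<rho> ?t = \<sigma>" using relabelling_exists[of ?t \<sigma>] t by auto
  have "labelled e (shape_of \<sigma>) (map \<rho> [0..<tree_size \<sigma>]) = map_rtree \<rho> ?t"
    unfolding labelled_def by (rule rtree.map_cong0) (use t in auto)
  then show thesis using \<rho> by (intro that) auto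
qed

section \<open>Expansions and Hoelder paths\<close>

text \<open>The forests without a coordinate in the expansion are the products and the trees that are too
  small, and both pair to zero.\<close>

lemma has_expansion_iff:
  fixes Z :: "('a hopf \<Rightarrow> real) set"
  assumes e: "vertex_enumeration e"
    and Z: "Z \<in> carrier (butcher_group N)" "trivial_upto (N div 2) Z"
  shows "has_expansion N e (high_shapes N) Z g \<longleftrightarrow>
    (\<forall>\<tau>\<in>high_shapes N. \<forall>a. length a = tree_size \<tau> \<longrightarrow> pairing Z {#labelled e \<tau> a#} = g \<tau> a)"
proof -
  have "pairing Z h = 0"
    if h: "1 \<le> forest_size h" "forest_size h \<le> N"
      "\<nexists>\<tau> a. \<tau> \<in> high_shapes N \<and> length a = tree_size \<tau> \<and> h = {#labelled e \<tau> a#}" for h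
  proof (cases "\<exists>\<sigma>. h = {#\<sigma>#}")
    case True
    then obtain \<sigma> where \<sigma>: "h = {#\<sigma>#}" by blast
    obtain a where a: "length a = tree_size \<sigma>" "labelled e (shape_of \<sigma>) a = \<sigma>"
      using labelled_surj[OF e] .
    with h(3) \<sigma> have "shape_of \<sigma> \<notin> high_shapes N"
      by (metis tree_size_shape_of)
    with h(2) Z(2) \<sigma> show ?thesis by (simp add: high_shapes_def trivial_upto_def)
  next
    case False
    with h show ?thesis by (intro pairing_products_zero[OF Z]) auto
  qed
  then show ?thesis using Z(1) by (auto simp: has_expansion_def pairing_empty)
qed

lemma finite_multi_indices: "finite {a :: 'a::finite list. length a = n}"
  using finite_lists_length_eq[of "UNIV :: 'a set" n] by simp

lemma abs_coordinate_le_tensor_norm: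
  fixes g :: "'a::finite tensor"
  assumes "length a = n"
  shows "\<bar>g a\<bar> \<le> tensor_norm n g"
proof -
  have "\<bar>g a\<bar> \<le> L2_set (\<lambda>a. \<bar>g a\<bar>) {a. length a = n}"
    by (rule member_le_L2_set[OF finite_multi_indices]) (use assms in auto)
  then show ?thesis by (simp add: tensor_norm_def L2_set_def)
qed

lemma holder_tensor_pathsI:
  fixes f :: "real \<Rightarrow> 'a::finite tensor"
  assumes tens: "\<And>t. t \<in> {0..T} \<Longrightarrow> f t \<in> tensors n"
    and bound: "\<And>a. length a = n \<Longrightarrow> \<exists>C. \<forall>s t. 0 \<le> s \<and> s < t \<and> t \<le> T \<longrightarrow>
      \<bar>f t a - f s a\<bar> \<le> C * \<bar>t - s\<bar> powr \<beta>"
  shows "f \<in> holder_tensor_paths \<beta> T n"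
proof -
  obtain C where C: "\<And>a s t. length a = n \<Longrightarrow> 0 \<le> s \<Longrightarrow> s < t \<Longrightarrow> t \<le> T \<Longrightarrow>
      \<bar>f t a - f s a\<bar> \<le> C a * \<bar>t - s\<bar> powr \<beta>"
    using bound by metis
  have C': "\<bar>f t a - f s a\<bar> \<le> C a * \<bar>t - s\<bar> powr \<beta>"
    if "length a = n" "s \<in> {0..T}" "t \<in> {0..T}" for a s t
    using that C[of a s t] C[of a t s]
    by (cases s t rule: linorder_cases) (auto simp: abs_minus_commute)
  have "tensor_norm n (f t - f s) \<le> (\<Sum>a | length a = n. C a) * \<bar>t - s\<bar> powr \<beta>"
    if "s \<in> {0..T}" "t \<in> {0..T}" for s t
  proof -
    have "tensor_norm n (f t - f s) \<le> (\<Sum>a | length a = n. \<bar>(f t - f s) a\<bar>)"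
      unfolding tensor_norm_def by (rule L2_set_le_sum_abs)
    also have "\<dots> \<le> (\<Sum>a | length a = n. C a * \<bar>t - s\<bar> powr \<beta>)"
      by (rule sum_mono) (use C' that in auto)
    finally show ?thesis by (simp add: sum_distrib_right)
  qed
  with tens show ?thesis unfolding holder_tensor_paths_def by blast
qed

text \<open>The empty forest satisfies its bound with constant \<open>1\<close>: the increment pairs to \<open>1\<close> with it and
  the exponent is \<open>0\<close>. On the other forests increments are differences, by additivity.\<close>

lemma branched_rough_path_iff:
  assumes X: "\<And>t. t \<in> {0..T} \<Longrightarrow> X t \<in> carrier (butcher_group N)"
    and triv: "\<And>t. t \<in> {0..T} \<Longrightarrow> trivial_upto (N div 2) (X t)"
  shows "branched_rough_path \<gamma> N T X \<longleftrightarrow>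
    (\<forall>F. F \<noteq> {#} \<longrightarrow> forest_size F \<le> N \<longrightarrow> (\<exists>C. \<forall>s t. 0 \<le> s \<and> s < t \<and> t \<le> T \<longrightarrow>
      \<bar>pairing (X t) F - pairing (X s) F\<bar> \<le> C * \<bar>t - s\<bar> powr (\<gamma> * real (forest_size F))))"
    (is "_ \<longleftrightarrow> (\<forall>F. F \<noteq> {#} \<longrightarrow> _ \<longrightarrow> ?H F)")
proof -
  let ?S = "\<lambda>F. {\<bar>pairing (increment N X s t) F\<bar> / \<bar>t - s\<bar> powr (\<gamma> * real (forest_size F)) |
          s t. 0 \<le> s \<and> s < t \<and> t \<le> T}"
  have empty: "bdd_above (?S {#})"
    by (rule bdd_aboveI[of _ 1])
      (use X triv in \<open>auto simp: pairing_empty[OF increment_in_carrier]\<close>)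
  have nonempty: "bdd_above (?S F) \<longleftrightarrow> ?H F" if F: "F \<noteq> {#}" "forest_size F \<le> N" for F
  proof -
    have inc: "pairing (increment N X s t) F = pairing (X t) F - pairing (X s) F"
      if "0 \<le> s" "s < t" "t \<le> T" for s t
      using pairing_increment[of X s N t F] X triv F that by auto
    have pos: "0 < \<bar>t - s\<bar> powr (\<gamma> * real (forest_size F))" if "s < t" for s t using that by simp
    have "bdd_above (?S F) \<longleftrightarrow> (\<exists>C. \<forall>s t. 0 \<le> s \<and> s < t \<and> t \<le> T \<longrightarrow>
        \<bar>pairing (increment N X s t) F\<bar> / \<bar>t - s\<bar> powr (\<gamma> * real (forest_size F)) \<le> C)"
      unfolding bdd_above_def by blast
    also have "\<dots> \<longleftrightarrow> ?H F"
      using inc pos by (simp add: pos_divide_le_eq cong: conj_cong imp_cong)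
    finally show ?thesis .
  qed
  have "(forest_size F \<le> N \<longrightarrow> bdd_above (?S F)) \<longleftrightarrow> (F \<noteq> {#} \<longrightarrow> forest_size F \<le> N \<longrightarrow> ?H F)" for F
    using empty nonempty[of F] by (cases "F = {#}") auto
  then have "(\<forall>F. forest_size F \<le> N \<longrightarrow> bdd_above (?S F)) \<longleftrightarrow>
      (\<forall>F. F \<noteq> {#} \<longrightarrow> forest_size F \<le> N \<longrightarrow> ?H F)"
    by (rule iff_allI)
  with X show ?thesis by (simp add: branched_rough_path_def)
qed

lemma increment_expansion:
  assumes e: "vertex_enumeration e"
    and s: "X s \<in> carrier (butcher_group N)" "trivial_upto (N div 2) (X s)"
    and t: "X t \<in> carrier (butcher_group N)" "trivial_upto (N div 2) (X t)"
    and f: "has_expansion N e (high_shapes N) (X s) (\<lambda>\<tau>. f \<tau> s)"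
      "has_expansion N e (high_shapes N) (X t) (\<lambda>\<tau>. f \<tau> t)"
  shows "has_expansion N e (high_shapes N) (increment N X s t) (\<lambda>\<tau>. f \<tau> t - f \<tau> s)"
proof -
  have diff: "pairing (increment N X s t) {#\<sigma>#} = pairing (X t) {#\<sigma>#} - pairing (X s) {#\<sigma>#}"
    if "tree_size \<sigma> \<le> N" for \<sigma>
    using that by (intro pairing_increment[OF s t]) auto
  have "trivial_upto (N div 2) (increment N X s t)"
    using s(2) t(2) by (simp add: trivial_upto_def diff)
  note iff = has_expansion_iff[OF e increment_in_carrier[OF s t] this]
  show ?thesis
    unfolding iff using f by (auto simp: has_expansion_def diff tree_size_labelled[OF e] high_shapes_def)
qed

theorem corollary5p2:
  fixes N :: nat and T \<gamma> :: real
    and X :: "real \<Rightarrow> ('d::finite hopf \<Rightarrow> real) set"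
    and e :: "shape \<Rightarrow> nat rtree"
  assumes "N \<ge> 1" and "T > 0"
    and "1 / (real N + 1) < \<gamma>" and "\<gamma> \<le> 1 / real N"
    and "vertex_enumeration e"
    and "\<And>t. t \<in> {0..T} \<Longrightarrow> X t \<in> carrier (butcher_group N)"
    and "\<And>t \<sigma>. t \<in> {0..T} \<Longrightarrow> tree_size \<sigma> \<le> N div 2 \<Longrightarrow> pairing (X t) {#\<sigma>#} = 0"
  shows "(branched_rough_path \<gamma> N T X \<longleftrightarrow>
           (\<exists>f :: shape \<Rightarrow> real \<Rightarrow> 'd tensor.
              (\<forall>\<tau>\<in>high_shapes N.
                 f \<tau> \<in> holder_tensor_paths (\<gamma> * real (tree_size \<tau>)) T (tree_size \<tau>)) \<and>
              (\<forall>t\<in>{0..T}. has_expansion N e (high_shapes N) (X t) (\<lambda>\<tau>. f \<tau> t))))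
       \<and> (\<forall>f :: shape \<Rightarrow> real \<Rightarrow> 'd tensor.
              (\<forall>\<tau>\<in>high_shapes N.
                 f \<tau> \<in> holder_tensor_paths (\<gamma> * real (tree_size \<tau>)) T (tree_size \<tau>)) \<and>
              (\<forall>t\<in>{0..T}. has_expansion N e (high_shapes N) (X t) (\<lambda>\<tau>. f \<tau> t))
            \<longrightarrow> (\<forall>s\<in>{0..T}. \<forall>t\<in>{0..T}. s < t \<longrightarrow>
                   has_expansion N e (high_shapes N) (increment N X s t) (\<lambda>\<tau>. f \<tau> t - f \<tau> s)))"
proof -
  note e = assms(5) and X = assms(6)
  have triv: "trivial_upto (N div 2) (X t)" if "t \<in> {0..T}" for t
    using assms(7) that by (simp add: trivial_upto_def)
  let ?expansion = "\<lambda>f :: shape \<Rightarrow> real \<Rightarrow> 'd tensor.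
    \<forall>t\<in>{0..T}. has_expansion N e (high_shapes N) (X t) (\<lambda>\<tau>. f \<tau> t)"
  let ?holder = "\<lambda>f :: shape \<Rightarrow> real \<Rightarrow> 'd tensor. \<forall>\<tau>\<in>high_shapes N.
    f \<tau> \<in> holder_tensor_paths (\<gamma> * real (tree_size \<tau>)) T (tree_size \<tau>)"
  have incr: "has_expansion N e (high_shapes N) (increment N X s t) (\<lambda>\<tau>. f \<tau> t - f \<tau> s)"
    if f: "?expansion f" and st: "s \<in> {0..T}" "t \<in> {0..T}" for f s t
    using increment_expansion[OF e X[OF st(1)] triv[OF st(1)] X[OF st(2)] triv[OF st(2)]] f st by blast
  have rough: "branched_rough_path \<gamma> N T X \<longleftrightarrow>
    (\<forall>F. F \<noteq> {#} \<longrightarrow> forest_size F \<le> N \<longrightarrow> (\<exists>C. \<forall>s t. 0 \<le> s \<and> s < t \<and> t \<le> T \<longrightarrow>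
      \<bar>pairing (X t) F - pairing (X s) F\<bar> \<le> C * \<bar>t - s\<bar> powr (\<gamma> * real (forest_size F))))"
    using X triv by (rule branched_rough_path_iff)
  have "\<exists>f. ?holder f \<and> ?expansion f" if rp: "branched_rough_path \<gamma> N T X"
  proof -
    have bound: "\<exists>C. \<forall>s t. 0 \<le> s \<and> s < t \<and> t \<le> T \<longrightarrow>
        \<bar>pairing (X t) F - pairing (X s) F\<bar> \<le> C * \<bar>t - s\<bar> powr (\<gamma> * real (forest_size F))"
      if "F \<noteq> {#}" "forest_size F \<le> N" for F
      using rough[THEN iffD1, OF rp, rule_format, OF that] .
    define f :: "shape \<Rightarrow> real \<Rightarrow> 'd tensor" where
      "f = (\<lambda>\<tau> t a. if length a = tree_size \<tau> then pairing (X t) {#labelled e \<tau> a#} else 0)"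
    have "f \<tau> \<in> holder_tensor_paths (\<gamma> * real (tree_size \<tau>)) T (tree_size \<tau>)"
      if \<tau>: "\<tau> \<in> high_shapes N" for \<tau>
    proof (rule holder_tensor_pathsI)
      show "f \<tau> t \<in> tensors (tree_size \<tau>)" for t by (simp add: f_def tensors_def)
      fix a :: "'d list" assume a: "length a = tree_size \<tau>"
      have size: "forest_size {#labelled e \<tau> a#} = tree_size \<tau>" by (simp add: tree_size_labelled[OF e])
      have "forest_size {#labelled e \<tau> a#} \<le> N" unfolding size using \<tau> by (simp add: high_shapes_def)
      from bound[OF _ this] have "\<exists>C. \<forall>s t. 0 \<le> s \<and> s < t \<and> t \<le> T \<longrightarrow>
          \<bar>pairing (X t) {#labelled e \<tau> a#} - pairing (X s) {#labelled e \<tau> a#}\<bar>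
            \<le> C * \<bar>t - s\<bar> powr (\<gamma> * real (forest_size {#labelled e \<tau> a#}))"
        by simp
      then show "\<exists>C. \<forall>s t. 0 \<le> s \<and> s < t \<and> t \<le> T \<longrightarrow>
          \<bar>f \<tau> t a - f \<tau> s a\<bar> \<le> C * \<bar>t - s\<bar> powr (\<gamma> * real (tree_size \<tau>))"
        using a by (simp only: size f_def simp_thms if_True)
    qed
    moreover have "?expansion f"
      using has_expansion_iff[OF e X triv] by (simp add: f_def)
    ultimately show ?thesis by blast
  qed
  moreover have "branched_rough_path \<gamma> N T X" if f: "?holder f" "?expansion f" for f
    unfolding rough
  proof (intro allI impI)
    fix F :: "'d forest" assume F: "F \<noteq> {#}" "forest_size F \<le> N"
    show "\<exists>C. \<forall>s t. 0 \<le> s \<and> s < t \<and> t \<le> T \<longrightarrow>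
      \<bar>pairing (X t) F - pairing (X s) F\<bar> \<le> C * \<bar>t - s\<bar> powr (\<gamma> * real (forest_size F))"
    proof (cases "\<exists>\<tau> a. \<tau> \<in> high_shapes N \<and> length a = tree_size \<tau> \<and> F = {#labelled e \<tau> a#}")
      case True
      then obtain \<tau> and a :: "'d list" where \<tau>: "\<tau> \<in> high_shapes N" "length a = tree_size \<tau>" "F = {#labelled e \<tau> a#}"
        by blast
      obtain C where C: "tensor_norm (tree_size \<tau>) (f \<tau> t - f \<tau> s) \<le> C * \<bar>t - s\<bar> powr (\<gamma> * real (tree_size \<tau>))"
        if "s \<in> {0..T}" "t \<in> {0..T}" for s t
        using f(1) \<tau>(1) unfolding holder_tensor_paths_def by blast
      have "\<bar>pairing (X t) F - pairing (X s) F\<bar> \<le> C * \<bar>t - s\<bar> powr (\<gamma> * real (forest_size F))"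
        if "0 \<le> s \<and> s < t \<and> t \<le> T" for s t
      proof -
        have st: "s \<in> {0..T}" "t \<in> {0..T}" using that by auto
        have "pairing (X r) F = f \<tau> r a" if "r \<in> {0..T}" for r
          using f(2) \<tau> that by (simp add: has_expansion_def)
        with st have "\<bar>pairing (X t) F - pairing (X s) F\<bar> = \<bar>(f \<tau> t - f \<tau> s) a\<bar>" by simp
        also have "\<dots> \<le> tensor_norm (tree_size \<tau>) (f \<tau> t - f \<tau> s)"
          using \<tau>(2) by (rule abs_coordinate_le_tensor_norm)
        finally show ?thesis using C[OF st] by (simp add: \<tau>(3) tree_size_labelled[OF e])
      qed
      then show ?thesis by blast
    next
      case False
      have "1 \<le> forest_size F" using F(1) forest_size_eq_0[of F] by linarith
      with False F(2) f(2) have "pairing (X r) F = 0" if "r \<in> {0..T}" for r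
        using that unfolding has_expansion_def by blast
      then show ?thesis by (intro exI[of _ 0]) auto
    qed
  qed
  ultimately show ?thesis using incr by blast
qed

end
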